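(* Let $D$ be an infinite (countable) twin-free oriented graph. Then there is a proper subset of $V(D)$ which is an identifying code of $D$, unless $D\in\Psi(H)$ for some finite or infinite oriented graph $H$.
   Context: Oriented graphs have no loops, no multiple arcs and no pair of symmetric arcs; all vertex sets are finite or countably infinite. For a vertex $x$, $B_1^+(x)$ is the set consisting of $x$ and all $w$ with an arc from $w$ to $x$; a source is a vertex with no incoming arc. Vertices $u\neq v$ are twins if $B_1^+(u)=B_1^+(v)$; twin-free means no twins. An identifying code of $D$ is a set $C\subseteq V(D)$ with $B_1^+(u)\cap C\neq\emptyset$ for all $u$ and $B_1^+(u)\cap C\neq B_1^+(v)\cap C$ for all distinct $u,v$. The transitive closure of a digraph adds an arc $\overrightarrow{ab}$ whenever there is a directed path from $a$ to $b$. A connected (possibly infinite) oriented graph $T$ is an $fst$-tree if (1) for each vertex $x$, $B_1^+(x)$ induces the transitive closure of a finite directed path $P_x$ with vertex set $B_1^+(x)$ ending at $x$, and (2) for each pair $x,y$ there is a vertex $z$ with $V(P_x)\cap V(P_y)=V(P_z)$. An oriented graph $T$ is an $ist$-tree if (1) for each vertex $x$, $B_1^+(x)$ induces the transitive closure of an infinite directed path $P_x=\cdots x_{-2}x_{-1}x_0$ with $x_0=x$ and vertex set $B_1^+(x)$, and (2) for each pair $x,y$ there is a vertex $z$ with $V(P_x)\cap V(P_y)=V(P_z)$. For an oriented graph $H$, $\Psi(H)$ is the family of all digraphs obtained as follows: to each vertex $x$ of $H$ assign an $fst$-tree $T_x$ if $x$ is a source of $H$, and an $ist$-tree $T_x$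 otherwise (arbitrary choices, pairwise vertex-disjoint); to each arc $\overrightarrow{xy}$ of $H$ assign an arbitrary subset $V_{\overrightarrow{xy}}\subseteq V(T_x)$; the resulting digraph has vertex set $\bigcup_x V(T_x)$, all arcs of all $T_x$, and an arc $\overrightarrow{zt}$ for every arc $\overrightarrow{xy}$ of $H$, every $z\in V_{\overrightarrow{xy}}$ and every $t\in V(T_y)$. *)

theory Defs
  imports "Graph_Theory.Graph_Theory" "HOL-Library.Countable_Set"
begin

definition oriented_graph :: "'a pair_pre_digraph \<Rightarrow> bool" where
  "oriented_graph D \<longleftrightarrow>
     pair_loopfree_digraph D \<and> countable (pverts D) \<and>
     (\<forall>u v. (u, v) \<in> parcs D \<longrightarrow> (v, u) \<notin> parcs D)"

definition in_ball :: "'a pair_pre_digraph \<Rightarrow> 'a \<Rightarrow> 'a set" where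
  "in_ball D x = insert x {w. (w, x) \<in> parcs D}"

definition is_source :: "'a pair_pre_digraph \<Rightarrow> 'a \<Rightarrow> bool" where
  "is_source D x \<longleftrightarrow> x \<in> pverts D \<and> in_arcs (with_proj D) x = {}"

definition twins :: "'a pair_pre_digraph \<Rightarrow> 'a \<Rightarrow> 'a \<Rightarrow> bool" where
  "twins D u v \<longleftrightarrow> u \<noteq> v \<and> in_ball D u = in_ball D v"

definition twin_free :: "'a pair_pre_digraph \<Rightarrow> bool" where
  "twin_free D \<longleftrightarrow> (\<forall>u \<in> pverts D. \<forall>v \<in> pverts D. \<not> twins D u v)"

definition identifying_code :: "'a pair_pre_digraph \<Rightarrow> 'a set \<Rightarrow> bool" where
  "identifying_code D C \<longleftrightarrow>
     C \<subseteq> pverts D \<and>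
     (\<forall>u \<in> pverts D. in_ball D u \<inter> C \<noteq> {}) \<and>
     (\<forall>u \<in> pverts D. \<forall>v \<in> pverts D. u \<noteq> v \<longrightarrow> in_ball D u \<inter> C \<noteq> in_ball D v \<inter> C)"

text \<open>The library relation \<open>reachable1\<close> holds for \<open>a\<close>, \<open>b\<close> joined by a walk with at least one arc.
  The closure is only applied to paths, where such walks are paths with distinct ends.\<close>

definition transitive_closure :: "'a pair_pre_digraph \<Rightarrow> 'a pair_pre_digraph" where
  "transitive_closure G =
     \<lparr> pverts = pverts G, parcs = {(a, b). a \<rightarrow>\<^sup>+\<^bsub>with_proj G\<^esub> b} \<rparr>"

definition finite_dipath_to :: "'a \<Rightarrow> 'a pair_pre_digraph \<Rightarrow> bool" where
  "finite_dipath_to x P \<longleftrightarrow>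
     (\<exists>xs. xs \<noteq> [] \<and> distinct xs \<and> last xs = x \<and>
        P = \<lparr> pverts = set xs, parcs = {(xs ! i, xs ! Suc i) | i. Suc i < length xs} \<rparr>)"

text \<open>The path \<open>\<dots> x\<^sub>-\<^sub>2 x\<^sub>-\<^sub>1 x\<^sub>0\<close> is given by \<open>p n = x\<^sub>-\<^sub>n\<close>; arcs decrease the argument of \<open>p\<close>.\<close>

definition infinite_dipath_to :: "'a \<Rightarrow> 'a pair_pre_digraph \<Rightarrow> bool" where
  "infinite_dipath_to x P \<longleftrightarrow>
     (\<exists>p :: nat \<Rightarrow> 'a. inj p \<and> p 0 = x \<and>
        P = \<lparr> pverts = range p, parcs = {(p (Suc n), p n) | n. True} \<rparr>)"

definition in_ball_induces_closure :: "'a pair_pre_digraph \<Rightarrow> 'a \<Rightarrow> 'a pair_pre_digraph \<Rightarrow> bool" where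
  "in_ball_induces_closure T x P \<longleftrightarrow>
     pverts P = in_ball T x \<and>
     induced_subgraph (with_proj (transitive_closure P)) (with_proj T)"

text \<open>The library's \<open>connected\<close> (weak connectivity) excludes the empty digraph.\<close>

definition fst_tree :: "'a pair_pre_digraph \<Rightarrow> bool" where
  "fst_tree T \<longleftrightarrow>
     oriented_graph T \<and> connected (with_proj T) \<and>
     (\<exists>P :: 'a \<Rightarrow> 'a pair_pre_digraph.
        (\<forall>x \<in> pverts T. finite_dipath_to x (P x) \<and> in_ball_induces_closure T x (P x)) \<and>
        (\<forall>x \<in> pverts T. \<forall>y \<in> pverts T. \<exists>z \<in> pverts T.
           pverts (P x) \<inter> pverts (P y) = pverts (P z)))"

text \<open>No connectivity is required here: condition (2) implies it for nonempty \<open>T\<close>. The empty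
  digraph satisfies both conditions and is an \<open>ist\<close>-tree. This matters for \<open>Psi\<close>: with nonempty
  trees only, an \<open>ist\<close>-tree by itself would belong to no \<open>Psi H\<close>, since a one-vertex \<open>H\<close> has
  a source.\<close>

definition ist_tree :: "'a pair_pre_digraph \<Rightarrow> bool" where
  "ist_tree T \<longleftrightarrow>
     oriented_graph T \<and>
     (\<exists>P :: 'a \<Rightarrow> 'a pair_pre_digraph.
        (\<forall>x \<in> pverts T. infinite_dipath_to x (P x) \<and> in_ball_induces_closure T x (P x)) \<and>
        (\<forall>x \<in> pverts T. \<forall>y \<in> pverts T. \<exists>z \<in> pverts T.
           pverts (P x) \<inter> pverts (P y) = pverts (P z)))"

definition Psi :: "'b pair_pre_digraph \<Rightarrow> 'a pair_pre_digraph set" where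
  "Psi H = {D. \<exists>(T :: 'b \<Rightarrow> 'a pair_pre_digraph) (V :: 'b \<times> 'b \<Rightarrow> 'a set).
     (\<forall>x \<in> pverts H. if is_source H x then fst_tree (T x) else ist_tree (T x)) \<and>
     (\<forall>x \<in> pverts H. \<forall>y \<in> pverts H. x \<noteq> y \<longrightarrow> pverts (T x) \<inter> pverts (T y) = {}) \<and>
     (\<forall>(x, y) \<in> parcs H. V (x, y) \<subseteq> pverts (T x)) \<and>
     D = \<lparr> pverts = (\<Union>x \<in> pverts H. pverts (T x)),
           parcs = (\<Union>x \<in> pverts H. parcs (T x)) \<union>
                   (\<Union>(x, y) \<in> parcs H. V (x, y) \<times> pverts (T y)) \<rparr>}"

end

theory Submission
  imports Defs
begin

text \<open>Suppose that no proper subset of \<open>V(D)\<close> is an identifying code. Deleting a vertex \<open>x\<close> from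
  \<open>V(D)\<close> then leaves a vertex undominated, which makes \<open>x\<close> a source, or leaves a pair unseparated,
  so that two closed in-neighbourhoods differ exactly in \<open>x\<close>. As \<open>D\<close> is oriented, the larger one
  must be that of \<open>x\<close> itself: \<open>B(x) = {x} \<union> B(f x)\<close> with \<open>x \<notin> B(f x)\<close>. Put \<open>f x = x\<close> for sources.
  The trees of the functional graph of \<open>f\<close> are the trees of a decomposition: inside a tree, \<open>B(x)\<close>
  is the orbit of \<open>x\<close>, and a vertex outside a tree belongs to \<open>B(x)\<close> either for all \<open>x\<close> in the
  tree or for none. A tree is an \<open>fst\<close>-tree if it contains a source of \<open>D\<close> and an \<open>ist\<close>-tree
  otherwise.\<close>

section \<open>Paths indexed by natural numbers\<close>

text \<open>One encoding for both kinds of path: \<open>I\<close> will be an initial segment or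
  \<open>UNIV\<close>. Arcs lower the index, so the path ends at \<open>p 0\<close>.\<close>

definition index_path :: "(nat \<Rightarrow> 'a) \<Rightarrow> nat set \<Rightarrow> 'a pair_pre_digraph" where
  "index_path p I = \<lparr> pverts = p ` I, parcs = {(p (Suc n), p n) | n. Suc n \<in> I} \<rparr>"

text \<open>By injectivity a vertex determines its index, so each further arc of a walk lowers the
  index by exactly one. Conversely, one descends from \<open>i\<close> to \<open>j\<close> one arc
  at a time, staying in the down-closed set \<open>I\<close>.\<close>

lemma parcs_transitive_closure_index_path:
  assumes down: "\<And>i j. i \<in> I \<Longrightarrow> j < i \<Longrightarrow> j \<in> I" and inj: "inj_on p I"
  shows "parcs (transitive_closure (index_path p I)) = {(p i, p j) | i j. j < i \<and> i \<in> I}"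
proof -
  let ?A = "parcs (index_path p I)"
  have "\<exists>i j. a = p i \<and> b = p j \<and> j < i \<and> i \<in> I" if "(a, b) \<in> ?A\<^sup>+" for a b
    using that
  proof (induction rule: trancl_induct)
    case (base b)
    then show ?case by (auto simp: index_path_def)
  next
    case (step b c)
    then obtain i j where ij: "a = p i" "b = p j" "j < i" "i \<in> I" by blast
    from step obtain n where n: "b = p (Suc n)" "c = p n" "Suc n \<in> I"
      by (auto simp: index_path_def)
    have "j \<in> I" using down ij by blast
    then have "j = Suc n" using inj n ij by (metis inj_onD)
    then show ?case using ij n by (intro exI[of _ i] exI[of _ n]) auto
  qed
  moreover have "(p i, p j) \<in> ?A\<^sup>+" if "j < i" "i \<in> I" for i j
    using that
  proof (induction i)
    case (Suc i)
    have arc: "(p (Suc i), p i) \<in> ?A" using Suc.prems by (auto simp: index_path_def)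
    show ?case
    proof (cases "j = i")
      case True
      then show ?thesis using arc by blast
    next
      case False
      then have "(p i, p j) \<in> ?A\<^sup>+" using Suc down[of "Suc i" i] by auto
      then show ?thesis using arc by (rule trancl_into_trancl2[rotated])
    qed
  qed simp
  ultimately show ?thesis by (auto simp: transitive_closure_def)
qed

lemma finite_dipath_to_index_path:
  assumes "inj_on p {..k}"
  shows "finite_dipath_to (p 0) (index_path p {..k})"
proof -
  \<comment> \<open>A list path ends at its last entry and an indexed path at \<open>p 0\<close>,
    hence the reversal.\<close>
  define xs where "xs = rev (map p [0..<Suc k])"
  have len: "length xs = Suc k" by (simp add: xs_def)
  have nth: "xs ! i = p (k - i)" if "i \<le> k" for i
    using that by (simp add: xs_def rev_nth del: upt_Suc)
  have "distinct xs" using assms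
    by (auto simp: xs_def distinct_map atLeast0LessThan lessThan_Suc_atMost simp del: upt_Suc)
  moreover have "set xs = p ` {..k}"
    by (auto simp: xs_def simp del: upt_Suc)
  moreover have "last xs = p 0" using len nth[of k] by (simp add: last_conv_nth flip: length_0_conv)
  moreover have "{(xs ! i, xs ! Suc i) | i. Suc i < length xs} = {(p (Suc n), p n) | n. Suc n \<in> {..k}}"
    (is "?L = ?R")
  proof (intro set_eqI iffI)
    fix e assume "e \<in> ?L"
    then obtain i where i: "e = (xs ! i, xs ! Suc i)" "Suc i \<le> k" using len by auto
    then have "e = (p (Suc (k - Suc i)), p (k - Suc i))" by (simp add: nth Suc_diff_Suc)
    then show "e \<in> ?R" using i by auto
  next
    fix e assume "e \<in> ?R"
    then obtain n where n: "e = (p (Suc n), p n)" "Suc n \<le> k" by auto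
    then have "e = (xs ! (k - Suc n), xs ! Suc (k - Suc n))" by (simp add: nth Suc_diff_Suc)
    moreover have "Suc (k - Suc n) < length xs" using n len by simp
    ultimately show "e \<in> ?L" by blast
  qed
  ultimately show ?thesis
    unfolding finite_dipath_to_def index_path_def using len
    by (intro exI[of _ xs]) auto
qed

lemma infinite_dipath_to_index_path:
  assumes "inj p"
  shows "infinite_dipath_to (p 0) (index_path p UNIV)"
  using assms unfolding infinite_dipath_to_def index_path_def by auto

section \<open>The functional graph\<close>

definition restrict_graph :: "'a pair_pre_digraph \<Rightarrow> 'a set \<Rightarrow> 'a pair_pre_digraph" where
  "restrict_graph D S = \<lparr> pverts = S, parcs = parcs D \<inter> S \<times> S \<rparr>"

lemma in_ball_self [simp]: "x \<in> in_ball D x"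
  by (simp add: in_ball_def)

lemma in_ball_iff: "u \<in> in_ball D x \<longleftrightarrow> u = x \<or> (u, x) \<in> parcs D"
  by (auto simp: in_ball_def)

lemma is_source_iff: "is_source D x \<longleftrightarrow> x \<in> pverts D \<and> (\<forall>w. (w, x) \<notin> parcs D)"
  by (auto simp: is_source_def in_arcs_def)

lemma oriented_graphI:
  assumes "countable (pverts D)"
    and "\<And>u v. (u, v) \<in> parcs D \<Longrightarrow> u \<in> pverts D \<and> v \<in> pverts D \<and> u \<noteq> v \<and> (v, u) \<notin> parcs D"
  shows "oriented_graph D"
  unfolding oriented_graph_def pair_loopfree_digraph_def pair_loopfree_digraph_axioms_def
    pair_wf_digraph_def
  using assms by fastforce

lemma oriented_graphD:
  assumes "oriented_graph D" "(u, v) \<in> parcs D"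
  shows "u \<in> pverts D" "v \<in> pverts D" "u \<noteq> v" "(v, u) \<notin> parcs D"
  using assms unfolding oriented_graph_def pair_loopfree_digraph_def
    pair_loopfree_digraph_axioms_def pair_wf_digraph_def by fastforce+

lemma oriented_restrict_graph:
  assumes "oriented_graph D" "S \<subseteq> pverts D"
  shows "oriented_graph (restrict_graph D S)"
proof (rule oriented_graphI)
  show "countable (pverts (restrict_graph D S))"
    using assms by (auto simp: restrict_graph_def oriented_graph_def intro: countable_subset)
qed (use assms oriented_graphD[OF assms(1)] in \<open>auto simp: restrict_graph_def\<close>)

lemma funpow_funpow: "(f ^^ m) ((f ^^ n) x) = (f ^^ (m + n)) x"
  by (simp add: funpow_add)

section \<open>Balls along the orbits of \<open>f\<close>\<close>

text \<open>At a fixed source \<open>in_ball_f\<close> is trivial and \<open>x\<close> does lie in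
  \<open>in_ball D (f x)\<close>, so \<open>notin_ball_f\<close> speaks of non-sources only.\<close>

locale stem_map =
  fixes D :: "'a pair_pre_digraph" and f :: "'a \<Rightarrow> 'a"
  assumes oriented: "oriented_graph D"
    and f_in: "x \<in> pverts D \<Longrightarrow> f x \<in> pverts D"
    and f_source: "is_source D x \<Longrightarrow> f x = x"
    and in_ball_f: "x \<in> pverts D \<Longrightarrow> in_ball D x = insert x (in_ball D (f x))"
    and notin_ball_f: "x \<in> pverts D \<Longrightarrow> \<not> is_source D x \<Longrightarrow> x \<notin> in_ball D (f x)"
begin

definition orbit :: "'a \<Rightarrow> 'a set" where
  "orbit x = range (\<lambda>n. (f ^^ n) x)"

text \<open>Two vertices lie in one weak component of a functional graph exactly when their forward
  orbits meet.\<close>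

definition same_tree :: "'a \<Rightarrow> 'a \<Rightarrow> bool" where
  "same_tree x y \<longleftrightarrow> (\<exists>i j. (f ^^ i) x = (f ^^ j) y)"

definition tree_of :: "'a \<Rightarrow> 'a set" where
  "tree_of x = {y \<in> pverts D. same_tree x y}"

text \<open>The indices up to and including the first one that reaches a source, or all indices if
  there is none. Beyond them the orbit is constant.\<close>

definition stages :: "'a \<Rightarrow> nat set" where
  "stages x = {n. \<forall>m<n. \<not> is_source D ((f ^^ m) x)}"

text \<open>The path \<open>P_x\<close> of the tree definitions.\<close>

definition stem :: "'a \<Rightarrow> 'a pair_pre_digraph" where
  "stem x = index_path (\<lambda>n. (f ^^ n) x) (stages x)"

lemma funpow_in: "x \<in> pverts D \<Longrightarrow> (f ^^ n) x \<in> pverts D"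
  by (induction n) (auto simp: f_in)

lemma funpow_source: "is_source D x \<Longrightarrow> (f ^^ n) x = x"
  by (induction n) (auto simp: f_source)

lemma in_ball_funpow: "x \<in> pverts D \<Longrightarrow> in_ball D ((f ^^ n) x) \<subseteq> in_ball D x"
proof (induction n)
  case (Suc n)
  then show ?case using in_ball_f[OF funpow_in[of x n]] by auto
qed simp

lemma in_ball_mono: "x \<in> pverts D \<Longrightarrow> i \<le> j \<Longrightarrow> in_ball D ((f ^^ j) x) \<subseteq> in_ball D ((f ^^ i) x)"
  using in_ball_funpow[OF funpow_in, of x "j - i" i] by (simp add: funpow_funpow)

lemma same_tree_refl: "same_tree x x"
  unfolding same_tree_def by (intro exI) (rule refl)

lemma same_tree_sym: "same_tree x y \<Longrightarrow> same_tree y x"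
  unfolding same_tree_def by (blast intro: sym)

text \<open>Iterates of \<open>f\<close> commute, so both meeting points can be moved forward to a
  common one.\<close>

lemma same_tree_trans:
  assumes "same_tree x y" "same_tree y z" shows "same_tree x z"
proof -
  obtain i j k l where ij: "(f ^^ i) x = (f ^^ j) y" and kl: "(f ^^ k) y = (f ^^ l) z"
    using assms unfolding same_tree_def by blast
  have "(f ^^ (k + i)) x = (f ^^ k) ((f ^^ j) y)" by (simp add: funpow_funpow flip: ij)
  also have "\<dots> = (f ^^ j) ((f ^^ k) y)" by (simp add: funpow_funpow add.commute)
  also have "\<dots> = (f ^^ (j + l)) z" by (simp add: kl funpow_funpow)
  finally show ?thesis unfolding same_tree_def by blast
qed

lemma same_tree_funpow: "same_tree x ((f ^^ n) x)"
  unfolding same_tree_def by (rule exI[of _ n], rule exI[of _ 0]) simp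

lemma funpow_in_orbit: "(f ^^ n) x \<in> orbit x"
  unfolding orbit_def by (rule rangeI)

lemma orbitE:
  assumes "y \<in> orbit x" obtains n where "y = (f ^^ n) x"
  using assms unfolding orbit_def by (rule imageE)

lemma orbit_funpow: "y \<in> orbit x \<Longrightarrow> (f ^^ n) y \<in> orbit x"
  by (auto simp: funpow_funpow funpow_in_orbit elim!: orbitE)

lemma orbit_subset: "y \<in> orbit x \<Longrightarrow> orbit y \<subseteq> orbit x"
  by (auto intro: orbit_funpow elim!: orbitE[of _ y])

lemma orbit_in_ball: "x \<in> pverts D \<Longrightarrow> orbit x \<subseteq> in_ball D x"
  using in_ball_funpow in_ball_self by (metis orbitE subsetD subsetI)

text \<open>Each application of \<open>f\<close> changes the ball at most in the current orbit
  point, so vertices off the orbit are neither lost nor gained.\<close>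

lemma in_ball_funpow_iff:
  assumes "x \<in> pverts D" "u \<notin> orbit x"
  shows "u \<in> in_ball D ((f ^^ n) x) \<longleftrightarrow> u \<in> in_ball D x"
proof (induction n)
  case (Suc n)
  have "u \<noteq> (f ^^ n) x" using assms(2) by (auto simp: orbit_def)
  then show ?case using Suc in_ball_f[OF funpow_in[OF assms(1), of n]] by auto
qed simp

text \<open>Otherwise \<open>u\<close> survives in the ball of the common point
  \<open>(f ^^ i) u\<close> of the two orbits. This point is not \<open>u\<close>, so
  \<open>u\<close> is no source and \<open>i\<close> is positive. But \<open>u\<close> leaves its
  ball at the first application of \<open>f\<close>, and later balls only shrink.\<close>

lemma in_ball_same_tree:
  assumes "v \<in> pverts D" "u \<in> in_ball D v" "same_tree u v"
  shows "u \<in> orbit v"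
proof (rule ccontr)
  assume u: "u \<notin> orbit v"
  obtain i j where ij: "(f ^^ i) u = (f ^^ j) v" using assms unfolding same_tree_def by blast
  have uV: "u \<in> pverts D"
    using assms oriented_graphD[OF oriented] by (auto simp: in_ball_iff)
  have "u \<in> in_ball D ((f ^^ i) u)"
    using in_ball_funpow_iff[OF assms(1) u] assms(2) ij by simp
  have nu: "(f ^^ i) u \<noteq> u" using u ij by (auto simp: orbit_def)
  then have "\<not> is_source D u" using funpow_source by metis
  moreover have "i \<ge> 1" using nu by (cases i) auto
  ultimately show False
    using notin_ball_f[OF uV] in_ball_mono[OF uV, of 1 i] \<open>u \<in> in_ball D ((f ^^ i) u)\<close> by auto
qed

text \<open>A vertex outside the tree is on no orbit in it, so its membership passes from
  \<open>v\<close> to a common iterate and back to \<open>t\<close>.\<close>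

lemma in_ball_uniform:
  assumes "v \<in> pverts D" "t \<in> pverts D" "same_tree v t" "\<not> same_tree u v" "u \<in> in_ball D v"
  shows "u \<in> in_ball D t"
proof -
  obtain i j where ij: "(f ^^ i) v = (f ^^ j) t" using assms unfolding same_tree_def by blast
  have "u \<notin> orbit v" "u \<notin> orbit t"
    using assms(3,4) same_tree_funpow same_tree_sym same_tree_trans unfolding orbit_def by blast+
  then show ?thesis using assms ij in_ball_funpow_iff by metis
qed

section \<open>Orbits as paths\<close>

lemma stages_down: "i \<in> stages x \<Longrightarrow> j < i \<Longrightarrow> j \<in> stages x"
  unfolding stages_def by auto

text \<open>The point \<open>(f ^^ i) x\<close> is not a source, so it is absent from the next ball,
  which still contains the ball of \<open>(f ^^ j) x\<close> and hence that point itself.\<close>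

lemma funpow_neq:
  assumes "x \<in> pverts D" "j \<in> stages x" "i < j"
  shows "(f ^^ i) x \<noteq> (f ^^ j) x"
proof
  assume eq: "(f ^^ i) x = (f ^^ j) x"
  have "(f ^^ i) x \<notin> in_ball D ((f ^^ Suc i) x)"
    using assms notin_ball_f[OF funpow_in[OF assms(1)], of i] by (auto simp: stages_def)
  moreover have "(f ^^ j) x \<in> in_ball D ((f ^^ Suc i) x)"
    using in_ball_mono[OF assms(1), of "Suc i" j] assms(3) in_ball_self by (meson Suc_leI subsetD)
  ultimately show False using eq by simp
qed

lemma inj_on_stages: "x \<in> pverts D \<Longrightarrow> inj_on (\<lambda>n. (f ^^ n) x) (stages x)"
  by (rule linorder_inj_onI') (auto dest: funpow_neq)

lemma stages_finite:
  assumes "is_source D ((f ^^ k) x)"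
  shows "stages x = {..LEAST k. is_source D ((f ^^ k) x)}"
proof -
  let ?k = "LEAST k. is_source D ((f ^^ k) x)"
  have "is_source D ((f ^^ ?k) x)" using assms by (rule LeastI)
  moreover have "\<not> is_source D ((f ^^ m) x)" if "m < ?k" for m
    using that by (rule not_less_Least)
  ultimately show ?thesis unfolding stages_def by (auto simp: not_le[symmetric])
qed

lemma stages_infinite:
  assumes "\<nexists>k. is_source D ((f ^^ k) x)"
  shows "stages x = UNIV"
  using assms unfolding stages_def by auto

text \<open>From the first source on the orbit is stationary, so the indices cut off add no
  vertex.\<close>

lemma orbit_stages: "orbit x = (\<lambda>n. (f ^^ n) x) ` stages x"
proof (cases "\<exists>k. is_source D ((f ^^ k) x)")
  case True
  then obtain k where k: "is_source D ((f ^^ k) x)" by blast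
  let ?k = "LEAST k. is_source D ((f ^^ k) x)"
  have src: "is_source D ((f ^^ ?k) x)" using k by (rule LeastI)
  have "(f ^^ n) x \<in> (\<lambda>n. (f ^^ n) x) ` {..?k}" for n
  proof (cases "n \<le> ?k")
    case False
    then have "(f ^^ n) x = (f ^^ (n - ?k)) ((f ^^ ?k) x)" by (simp add: funpow_funpow)
    then show ?thesis using funpow_source[OF src] by auto
  qed auto
  then show ?thesis using stages_finite[OF k] by (auto simp: orbit_def)
next
  case False
  then show ?thesis by (simp add: stages_infinite orbit_def)
qed

lemma pverts_stem: "pverts (stem x) = orbit x"
  by (simp add: stem_def index_path_def orbit_stages)

text \<open>Balls shrink along the orbit, so every later point sends an arc to every earlier one.
  Arcs the other way are impossible in an oriented graph.\<close>

lemma parcs_closure_stem: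
  assumes "x \<in> pverts D"
  shows "parcs (transitive_closure (stem x)) = parcs D \<inter> orbit x \<times> orbit x"
proof -
  have arc: "((f ^^ i) x, (f ^^ j) x) \<in> parcs D" if "j < i" "i \<in> stages x" for i j
  proof -
    have "(f ^^ i) x \<in> in_ball D ((f ^^ j) x)" using in_ball_mono[OF assms, of j i] that by auto
    then show ?thesis using funpow_neq[OF assms that(2,1)] by (auto simp: in_ball_iff)
  qed
  have "parcs (transitive_closure (stem x)) =
      {((f ^^ i) x, (f ^^ j) x) | i j. j < i \<and> i \<in> stages x}"
    unfolding stem_def
    by (rule parcs_transitive_closure_index_path[OF stages_down inj_on_stages[OF assms]])
  moreover have "\<exists>i j. u = (f ^^ i) x \<and> v = (f ^^ j) x \<and> j < i \<and> i \<in> stages x"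
    if "(u, v) \<in> parcs D" "u \<in> orbit x" "v \<in> orbit x" for u v
  proof -
    obtain i j where ij: "u = (f ^^ i) x" "v = (f ^^ j) x" "i \<in> stages x" "j \<in> stages x"
      using \<open>u \<in> orbit x\<close> \<open>v \<in> orbit x\<close> unfolding orbit_stages by (elim imageE)
    have "j < i"
      using ij arc[of i j] oriented_graphD(3,4)[OF oriented that(1)]
      by (cases i j rule: linorder_cases) auto
    then show ?thesis using ij by blast
  qed
  ultimately show ?thesis using arc by (auto simp: orbit_def)
qed

section \<open>The trees and their defining conditions\<close>

lemma tree_of_in: "tree_of x \<subseteq> pverts D"
  by (auto simp: tree_of_def)

lemma orbit_in_tree_of:
  assumes "y \<in> tree_of x" shows "orbit y \<subseteq> tree_of x"
proof
  fix z assume "z \<in> orbit y"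
  then obtain n where "z = (f ^^ n) y" by (rule orbitE)
  then show "z \<in> tree_of x"
    using assms funpow_in[of y n] same_tree_trans[OF _ same_tree_funpow[of y n], of x]
    by (simp add: tree_of_def)
qed

lemma same_tree_in_tree_of: "y \<in> tree_of x \<Longrightarrow> z \<in> tree_of x \<Longrightarrow> same_tree y z"
  using same_tree_trans[OF same_tree_sym, of x y z] by (simp add: tree_of_def)

abbreviation tree_graph :: "'a \<Rightarrow> 'a pair_pre_digraph" where
  "tree_graph x \<equiv> restrict_graph D (tree_of x)"

text \<open>The orbit lies in the ball and in the tree. Conversely, \<open>in_ball_same_tree\<close>
  puts every ball vertex of the same tree on the orbit.\<close>

lemma in_ball_tree_graph:
  assumes "y \<in> tree_of x" shows "in_ball (tree_graph x) y = orbit y"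
proof -
  have y: "y \<in> pverts D" using assms tree_of_in by blast
  have "orbit y \<subseteq> in_ball (tree_graph x) y"
  proof
    fix u assume "u \<in> orbit y"
    then have "u \<in> in_ball D y" "u \<in> tree_of x"
      using orbit_in_ball[OF y] orbit_in_tree_of[OF assms] by blast+
    then show "u \<in> in_ball (tree_graph x) y"
      using assms by (auto simp: in_ball_iff restrict_graph_def)
  qed
  moreover have "in_ball (tree_graph x) y \<subseteq> orbit y"
  proof
    fix u assume "u \<in> in_ball (tree_graph x) y"
    then have "u \<in> in_ball D y" "u \<in> tree_of x"
      using assms by (auto simp: in_ball_iff restrict_graph_def)
    then show "u \<in> orbit y" using in_ball_same_tree[OF y] same_tree_in_tree_of assms by blast
  qed
  ultimately show ?thesis by blast
qed

lemma stem_induces_closure: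
  assumes "y \<in> tree_of x" shows "in_ball_induces_closure (tree_graph x) y (stem y)"
proof -
  have y: "y \<in> pverts D" using assms tree_of_in by blast
  have pv: "pverts (transitive_closure (stem y)) = orbit y"
    by (simp add: transitive_closure_def pverts_stem)
  have "parcs (transitive_closure (stem y)) \<subseteq> orbit y \<times> orbit y"
    using parcs_closure_stem[OF y] by blast
  then have "wf_digraph (with_proj (transitive_closure (stem y)))"
    unfolding wf_digraph_wp_iff pair_wf_digraph_def using pv by auto
  moreover have "wf_digraph (with_proj (tree_graph x))"
    unfolding wf_digraph_wp_iff pair_wf_digraph_def by (auto simp: restrict_graph_def)
  moreover have "pverts (tree_graph x) = tree_of x"
    "parcs (tree_graph x) = parcs D \<inter> tree_of x \<times> tree_of x"
    by (simp_all add: restrict_graph_def)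
  ultimately show ?thesis
    unfolding in_ball_induces_closure_def induced_subgraph_def subgraph_def
    using orbit_in_tree_of[OF assms]
    by (auto simp: pv pverts_stem in_ball_tree_graph[OF assms] parcs_closure_stem[OF y])
qed

text \<open>Condition (2) for trees. The witness is the first point of the orbit of \<open>y\<close>
  that lies on the orbit of \<open>z\<close>: every common point comes at or after it, and all its
  iterates are common.\<close>

lemma stem_inter:
  assumes "y \<in> tree_of x" "z \<in> tree_of x"
  shows "\<exists>w \<in> tree_of x. pverts (stem y) \<inter> pverts (stem z) = pverts (stem w)"
proof -
  obtain i j where "(f ^^ i) y = (f ^^ j) z"
    using same_tree_in_tree_of[OF assms] unfolding same_tree_def by blast
  then have ex: "(f ^^ i) y \<in> orbit z" by (auto simp: orbit_def)
  define m where "m = (LEAST i. (f ^^ i) y \<in> orbit z)"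
  have m: "(f ^^ m) y \<in> orbit z" unfolding m_def using ex by (rule LeastI)
  have my: "(f ^^ m) y \<in> orbit y" by (auto simp: orbit_def)
  have "orbit y \<inter> orbit z \<subseteq> orbit ((f ^^ m) y)"
  proof
    fix u assume u: "u \<in> orbit y \<inter> orbit z"
    then obtain n where n: "u = (f ^^ n) y" by (auto simp: orbit_def)
    then have "m \<le> n" using u unfolding m_def by (auto intro: Least_le)
    then have "u = (f ^^ (n - m)) ((f ^^ m) y)" using n by (simp add: funpow_funpow)
    then show "u \<in> orbit ((f ^^ m) y)" by (auto simp: orbit_def)
  qed
  then have "orbit y \<inter> orbit z = orbit ((f ^^ m) y)"
    using orbit_subset[OF m] orbit_subset[OF my] by blast
  moreover have "(f ^^ m) y \<in> tree_of x" using my orbit_in_tree_of[OF assms(1)] by blast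
  ultimately show ?thesis by (auto simp: pverts_stem)
qed

text \<open>Every vertex equals or is adjacent to each of its iterates, and two vertices of a tree
  share an iterate.\<close>

lemma connected_tree_graph:
  assumes "x \<in> pverts D" shows "connected (with_proj (tree_graph x))"
proof -
  let ?M = "with_proj (mk_symmetric (with_proj (tree_graph x)))"
  have "wf_digraph (with_proj (tree_graph x))"
    unfolding wf_digraph_wp_iff pair_wf_digraph_def by (auto simp: restrict_graph_def)
  then interpret M: wf_digraph ?M
    using wf_digraph.wellformed_mk_symmetric wf_digraph_wp_iff by blast
  have vM: "verts ?M = tree_of x" by (simp add: restrict_graph_def)
  have up: "y \<rightarrow>\<^sup>*\<^bsub>?M\<^esub> (f ^^ n) y" if "y \<in> tree_of x" for y n
  proof -
    have "(f ^^ n) y \<in> orbit y" by (auto simp: orbit_def)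
    then have "(f ^^ n) y = y \<or> ((f ^^ n) y, y) \<in> parcs (tree_graph x)"
      unfolding in_ball_tree_graph[OF that, symmetric] in_ball_iff .
    then show ?thesis
    proof
      assume "(f ^^ n) y = y"
      then show ?thesis using that vM by simp
    next
      assume "((f ^^ n) y, y) \<in> parcs (tree_graph x)"
      then have "(y, (f ^^ n) y) \<in> parcs (mk_symmetric (with_proj (tree_graph x)))"
        unfolding parcs_mk_symmetric by (intro UN_I[of "((f ^^ n) y, y)"]) auto
      then have "(y, (f ^^ n) y) \<in> arcs_ends ?M" by simp
      then show ?thesis by (rule M.reachable_adjI)
    qed
  qed
  have "y \<rightarrow>\<^sup>*\<^bsub>?M\<^esub> z" if yz: "y \<in> tree_of x" "z \<in> tree_of x" for y z
  proof -
    obtain i j where ij: "(f ^^ i) y = (f ^^ j) z"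
      using same_tree_in_tree_of[OF yz] unfolding same_tree_def by blast
    have "(f ^^ i) y \<rightarrow>\<^sup>*\<^bsub>?M\<^esub> z"
      unfolding ij using symmetric_reachable[OF symmetric_mk_symmetric up[OF yz(2)]] .
    then show ?thesis using up[OF yz(1)] M.reachable_trans by blast
  qed
  moreover have "x \<in> tree_of x" using assms same_tree_refl by (auto simp: tree_of_def)
  ultimately show ?thesis unfolding connected_def strongly_connected_def vM by blast
qed

section \<open>Trees with and without a source\<close>

text \<open>Sources are fixed, so iterating further from the common point of the two orbits ends in
  the same source. Reaching a source is thus a property of the whole tree.\<close>

lemma source_same_tree:
  assumes "is_source D ((f ^^ k) x)" "same_tree x y"
  shows "\<exists>l. is_source D ((f ^^ l) y)"
proof -
  obtain i j where ij: "(f ^^ i) x = (f ^^ j) y" using assms unfolding same_tree_def by blast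
  have "(f ^^ (k + j)) y = (f ^^ k) ((f ^^ i) x)" by (simp add: ij funpow_funpow)
  also have "\<dots> = (f ^^ i) ((f ^^ k) x)" by (simp add: funpow_funpow add.commute)
  also have "\<dots> = (f ^^ k) x" using assms(1) by (rule funpow_source)
  finally have "is_source D ((f ^^ (k + j)) y)" using assms(1) by simp
  then show ?thesis ..
qed

lemma fst_tree_tree_graph:
  assumes "x \<in> pverts D" "is_source D ((f ^^ k) x)"
  shows "fst_tree (tree_graph x)"
proof -
  have "finite_dipath_to y (stem y)" if "y \<in> tree_of x" for y
  proof -
    obtain l where "is_source D ((f ^^ l) y)"
      using source_same_tree[OF assms(2)] \<open>y \<in> tree_of x\<close> by (auto simp: tree_of_def)
    then show ?thesis
      using finite_dipath_to_index_path[of "\<lambda>n. (f ^^ n) y"] inj_on_stages[of y] tree_of_in that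
      by (auto simp: stem_def stages_finite)
  qed
  moreover have "pverts (tree_graph x) = tree_of x" by (simp add: restrict_graph_def)
  ultimately show ?thesis
    unfolding fst_tree_def
    using oriented_restrict_graph[OF oriented tree_of_in] connected_tree_graph[OF assms(1)]
      stem_induces_closure stem_inter
    by (intro conjI exI[of _ stem] ballI) simp_all
qed

lemma ist_tree_tree_graph:
  assumes "\<nexists>k. is_source D ((f ^^ k) x)"
  shows "ist_tree (tree_graph x)"
proof -
  have "infinite_dipath_to y (stem y)" if "y \<in> tree_of x" for y
  proof -
    have "\<nexists>l. is_source D ((f ^^ l) y)"
      using source_same_tree same_tree_sym assms that unfolding tree_of_def by blast
    then show ?thesis
      using infinite_dipath_to_index_path[of "\<lambda>n. (f ^^ n) y"] inj_on_stages[of y] tree_of_in that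
      by (auto simp: stem_def stages_infinite)
  qed
  moreover have "pverts (tree_graph x) = tree_of x" by (simp add: restrict_graph_def)
  ultimately show ?thesis
    unfolding ist_tree_def
    using oriented_restrict_graph[OF oriented tree_of_in] stem_induces_closure stem_inter
    by (intro conjI exI[of _ stem] ballI) simp_all
qed

text \<open>By uniformity an in-neighbour from another tree would also lie in the ball of the source
  \<open>(f ^^ k) v\<close>, which consists of that source alone. Hence trees with a source become
  sources of \<open>H\<close>.\<close>

lemma source_tree_no_outer_arc:
  assumes "is_source D ((f ^^ k) v)" "(u, v) \<in> parcs D"
  shows "same_tree u v"
proof (rule ccontr)
  assume n: "\<not> same_tree u v"
  have v: "v \<in> pverts D" using oriented_graphD(2)[OF oriented assms(2)] .
  have "u \<in> in_ball D v" using assms(2) by (simp add: in_ball_iff)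
  then have "u \<in> in_ball D ((f ^^ k) v)"
    by (rule in_ball_uniform[OF v funpow_in[OF v] same_tree_funpow n])
  then have "u = (f ^^ k) v" using assms(1) by (simp add: in_ball_iff is_source_iff)
  then show False using n same_tree_sym[OF same_tree_funpow[of v k]] by simp
qed

section \<open>Assembling \<open>D\<close> as a member of \<open>Psi H\<close>\<close>

text \<open>Countability lets the trees be numbered. The shift by 3 keeps \<open>0\<close>,
  \<open>1\<close>, \<open>2\<close> free for auxiliary vertices of \<open>H\<close>.\<close>

lemma exists_tree_index:
  "\<exists>c :: 'a \<Rightarrow> nat. (\<forall>x. c x \<ge> 3) \<and>
     (\<forall>x \<in> pverts D. \<forall>y \<in> pverts D. c x = c y \<longleftrightarrow> same_tree x y)"
proof -
  let ?g = "to_nat_on (tree_of ` pverts D)"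
  have "countable (tree_of ` pverts D)"
    using oriented by (simp add: oriented_graph_def)
  then have inj: "inj_on ?g (tree_of ` pverts D)" by (rule inj_on_to_nat_on)
  have "tree_of x = tree_of y \<longleftrightarrow> same_tree x y" if "x \<in> pverts D" "y \<in> pverts D" for x y
  proof
    assume "tree_of x = tree_of y"
    then show "same_tree x y" using that(2) same_tree_refl[of y] by (auto simp: tree_of_def)
  next
    assume "same_tree x y"
    then have "same_tree x z \<longleftrightarrow> same_tree y z" for z
      using same_tree_trans same_tree_sym by metis
    then show "tree_of x = tree_of y" by (simp add: tree_of_def)
  qed
  then show ?thesis
    using inj by (intro exI[of _ "\<lambda>x. ?g (tree_of x) + 3"]) (auto simp: inj_on_eq_iff)
qed

text \<open>A tree without sources may receive no arc from another tree, but an \<open>ist\<close>-tree is only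
  allowed at a vertex of \<open>H\<close> with an incoming arc. Such trees get an arc from a vertex \<open>0\<close>
  carrying the empty \<open>ist\<close>-tree, and the directed triangle \<open>0, 1, 2\<close> of empty trees keeps these
  vertices from being sources themselves.\<close>

lemma in_Psi: "\<exists>H :: nat pair_pre_digraph. oriented_graph H \<and> D \<in> Psi H"
proof -
  obtain c :: "'a \<Rightarrow> nat" where c3: "\<And>x. c x \<ge> 3"
    and c_eq: "\<And>x y. x \<in> pverts D \<Longrightarrow> y \<in> pverts D \<Longrightarrow> c x = c y \<longleftrightarrow> same_tree x y"
    using exists_tree_index by auto
  note arcD = oriented_graphD[OF oriented]
  \<comment> \<open>An arc between different trees extends from its tail to the whole tree of its
    head, as \<open>Psi\<close> demands.\<close>
  have uniform: "(u, t) \<in> parcs D"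
    if "(u, v) \<in> parcs D" "c u \<noteq> c v" "t \<in> pverts D" "c t = c v" for u v t
  proof -
    have "u \<in> in_ball D t"
      using in_ball_uniform[of v t u] that c_eq arcD[OF that(1)] same_tree_sym
      by (auto simp: in_ball_iff)
    then show ?thesis using that by (auto simp: in_ball_iff)
  qed
  define sourceless where "sourceless = {y \<in> pverts D. \<nexists>k. is_source D ((f ^^ k) y)}"
  define H where "H = \<lparr> pverts = {0, 1, 2} \<union> c ` pverts D,
    parcs = {(0, 1), (1, 2), (2, 0)} \<union> {(0, c y) | y. y \<in> sourceless} \<union>
      {(c u, c v) | u v. (u, v) \<in> parcs D \<and> c u \<noteq> c v} \<rparr>"
  have pH: "pverts H = {0, 1, 2} \<union> c ` pverts D"
    and aH: "parcs H = {(0, 1), (1, 2), (2, 0)} \<union> {(0, c y) | y. y \<in> sourceless} \<union>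
      {(c u, c v) | u v. (u, v) \<in> parcs D \<and> c u \<noteq> c v}"
    by (simp_all add: H_def)
  \<comment> \<open>Arcs in both directions between two trees would, by uniformity, yield arcs both
    ways between their tails \<open>u\<close> and \<open>u'\<close>.\<close>
  have no_opposite: False
    if "(u, v) \<in> parcs D" "(u', v') \<in> parcs D" "c u \<noteq> c v" "c u = c v'" "c v = c u'"
    for u v u' v'
  proof -
    have "(u, u') \<in> parcs D"
      using uniform[OF that(1,3) arcD(1)[OF that(2)] that(5)[symmetric]] .
    moreover have "c u' \<noteq> c v'" using that(3-5) by simp
    then have "(u', u) \<in> parcs D"
      by (rule uniform[OF that(2) _ arcD(1)[OF that(1)] that(4)])
    ultimately show False using arcD(4) by blast
  qed
  have arc_cases [consumes 1, case_names triangle sourceless cross]: thesis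
    if "(m, n) \<in> parcs H"
      and "(m, n) \<in> {(0, 1), (1, 2), (2, 0)} \<Longrightarrow> thesis"
      and "\<And>y. y \<in> sourceless \<Longrightarrow> m = 0 \<Longrightarrow> n = c y \<Longrightarrow> thesis"
      and "\<And>u v. (u, v) \<in> parcs D \<Longrightarrow> c u \<noteq> c v \<Longrightarrow> m = c u \<Longrightarrow> n = c v \<Longrightarrow> thesis"
    for m n thesis
    using that(1) unfolding aH
  proof (elim UnE)
    assume "(m, n) \<in> {(0, 1), (1, 2), (2, 0)}"
    then show thesis by (rule that(2))
  next
    assume "(m, n) \<in> {(0, c y) | y. y \<in> sourceless}"
    then obtain y where "(m, n) = (0, c y)" "y \<in> sourceless" by (elim CollectE exE conjE)
    then show thesis using that(3)[of y] by simp
  next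
    assume "(m, n) \<in> {(c u, c v) | u v. (u, v) \<in> parcs D \<and> c u \<noteq> c v}"
    then obtain u v where "(m, n) = (c u, c v)" "(u, v) \<in> parcs D" "c u \<noteq> c v"
      by (elim CollectE exE conjE)
    then show thesis using that(4)[of u v] by simp
  qed
  have "oriented_graph H"
  proof (rule oriented_graphI)
    fix m n assume "(m, n) \<in> parcs H"
    then show "m \<in> pverts H \<and> n \<in> pverts H \<and> m \<noteq> n \<and> (n, m) \<notin> parcs H"
    proof (cases rule: arc_cases)
      case triangle
      note mn = triangle
      have small: "m < 3" "n < 3" using mn by (elim insertE emptyE; simp)+
      have "(n, m) \<notin> parcs H"
      proof
        assume "(n, m) \<in> parcs H"
        then show False
        proof (cases rule: arc_cases)
          case triangle
          then show False using mn by (elim insertE emptyE) simp_all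
        next
          case (sourceless y)
          then show False using small c3[of y] by simp
        next
          case (cross u v)
          then show False using small c3[of u] by simp
        qed
      qed
      then show ?thesis using mn unfolding pH by (elim insertE emptyE) simp_all
    next
      case (sourceless y)
      note mn = sourceless
      have "(n, m) \<notin> parcs H"
      proof
        assume "(n, m) \<in> parcs H"
        then show False
        proof (cases rule: arc_cases)
          case triangle
          then show False using mn c3[of y] by (elim insertE emptyE) simp_all
        next
          case (sourceless z)
          then show False using mn c3[of y] by simp
        next
          case (cross u v)
          then show False using mn c3[of v] by simp
        qed
      qed
      moreover have "y \<in> pverts D" using mn(1) by (simp add: sourceless_def)
      ultimately show ?thesis using mn c3[of y] unfolding pH by simp
    next
      case (cross u v)
      note mn = cross
      have "(n, m) \<notin> parcs H"
      proof
        assume "(n, m) \<in> parcs H"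
        then show False
        proof (cases rule: arc_cases)
          case triangle
          then show False using mn c3[of u] by (elim insertE emptyE) simp_all
        next
          case (sourceless y)
          then show False using mn c3[of v] by simp
        next
          case (cross u' v')
          then show False using no_opposite[OF mn(1) cross(1) mn(2)] mn(3,4) by simp
        qed
      qed
      then show ?thesis using mn arcD(1,2)[OF mn(1)] unfolding pH by simp
    qed
  next
    show "countable (pverts H)" by (rule countableI_type)
  qed
  moreover have "D \<in> Psi H"
  proof -
    \<comment> \<open>For \<open>n < 3\<close> this is the empty digraph, since \<open>c\<close>
      takes values at least 3.\<close>
    define T where "T n = restrict_graph D {x \<in> pverts D. c x = n}" for n
    \<comment> \<open>One out-neighbour in \<open>T n\<close> suffices, since by
      \<open>uniform\<close> all of \<open>T n\<close> then follows. For the auxiliary arcs of the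
      triangle and from \<open>0\<close> the set is empty, so they contribute no arc to
      \<open>D\<close>.\<close>
    define V where "V = (\<lambda>(m, n). {u \<in> pverts D. c u = m \<and> (\<exists>v. (u, v) \<in> parcs D \<and> c v = n)})"
    have T_c: "T (c x) = tree_graph x" if "x \<in> pverts D" for x
      using that c_eq unfolding T_def tree_of_def by metis
    have trees: "if is_source H n then fst_tree (T n) else ist_tree (T n)" if n: "n \<in> pverts H" for n
    proof (cases "n \<in> c ` pverts D")
      case True
      then obtain x where x: "x \<in> pverts D" "n = c x" by blast
      show ?thesis
      proof (cases "\<exists>k. is_source D ((f ^^ k) x)")
        case True
        then obtain k where k: "is_source D ((f ^^ k) x)" by blast
        have source: "\<exists>l. is_source D ((f ^^ l) y)" if "y \<in> pverts D" "c y = n" for y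
          using source_same_tree[OF k, of y] c_eq[OF x(1) that(1)] that(2) x(2) by simp
        \<comment> \<open>A tree with a source receives no arc of \<open>H\<close>: the triangle
          avoids it, \<open>0\<close> points only to sourceless trees, and a cross arc contradicts
          \<open>source_tree_no_outer_arc\<close>.\<close>
        have "(m, n) \<notin> parcs H" for m
        proof
          assume "(m, n) \<in> parcs H"
          then show False
          proof (cases rule: arc_cases)
            case triangle
            then show False using x c3[of x] by (elim insertE emptyE) simp_all
          next
            case (sourceless y)
            then show False using source[of y] by (simp add: sourceless_def)
          next
            case (cross u v)
            note uv = arcD(1,2)[OF cross(1)]
            obtain l where "is_source D ((f ^^ l) v)"
              using source[OF uv(2)] cross(4) by auto
            then have "same_tree u v" using cross(1) by (rule source_tree_no_outer_arc)
            then show False using c_eq[OF uv] cross(2) by simp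
          qed
        qed
        then have "is_source H n" using n by (auto simp: is_source_iff)
        then show ?thesis using fst_tree_tree_graph[OF x(1) k] T_c x by simp
      next
        case False
        then have "x \<in> sourceless" using x by (simp add: sourceless_def)
        then have "(0, c x) \<in> {(0, c y) | y. y \<in> sourceless}"
          by (intro CollectI exI[of _ x] conjI) simp_all
        then have "(0, c x) \<in> parcs H" unfolding aH by (intro UnI1[OF UnI2])
        then have "\<not> is_source H n" unfolding is_source_iff x(2) by blast
        then show ?thesis using ist_tree_tree_graph[OF False] T_c x by simp
      qed
    next
      case False
      \<comment> \<open>The triangle gives each auxiliary vertex an incoming arc, so an
        \<open>ist\<close>-tree is required there, and the empty digraph is one.\<close>
      then have "n \<in> {0, 1, 2}" using n pH by blast
      moreover have "(2, 0) \<in> parcs H" "(0, 1) \<in> parcs H" "(1, 2) \<in> parcs H"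
        unfolding aH by simp_all
      ultimately have "\<not> is_source H n" unfolding is_source_iff by blast
      moreover have "oriented_graph (T n)"
        unfolding T_def by (rule oriented_restrict_graph[OF oriented]) blast
      moreover have "pverts (T n) = {}" using False by (auto simp: T_def restrict_graph_def)
      ultimately show ?thesis by (simp add: ist_tree_def)
    qed
    have "pverts D = (\<Union>n \<in> pverts H. pverts (T n))"
      by (auto simp: pH T_def restrict_graph_def)
    moreover have "parcs D = (\<Union>n \<in> pverts H. parcs (T n)) \<union>
        (\<Union>(m, n) \<in> parcs H. V (m, n) \<times> pverts (T n))" (is "_ = ?R")
    proof (intro set_eqI iffI)
      fix e assume e: "e \<in> parcs D"
      obtain u v where uv: "e = (u, v)" by (cases e)
      note d = arcD[OF e[unfolded uv]]
      show "e \<in> ?R"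
      proof (cases "c u = c v")
        case True
        then have "e \<in> parcs (T (c u))" "c u \<in> pverts H"
          using e uv d by (auto simp: T_def restrict_graph_def pH)
        then show ?thesis by blast
      next
        case False
        then have "(c u, c v) \<in> parcs H" unfolding aH
          using e uv by (intro UnI2 CollectI exI[of _ u] exI[of _ v] conjI) simp_all
        moreover have "e \<in> V (c u, c v) \<times> pverts (T (c v))"
          using e uv d by (auto simp: V_def T_def restrict_graph_def)
        ultimately show ?thesis by blast
      qed
    next
      fix e assume "e \<in> ?R"
      then consider n where "e \<in> parcs (T n)"
        | m n where "(m, n) \<in> parcs H" "e \<in> V (m, n) \<times> pverts (T n)" by blast
      then show "e \<in> parcs D"
      proof cases
        case 1
        then show ?thesis by (auto simp: T_def restrict_graph_def)
      next
        case 2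
        then obtain u t v where e: "e = (u, t)" "t \<in> pverts D" "c t = n" "c u = m"
          "(u, v) \<in> parcs D" "c v = n" by (auto simp: V_def T_def restrict_graph_def)
        \<comment> \<open>\<open>uniform\<close> applies only between different trees, and
          \<open>H\<close> has no loops.\<close>
        have "m \<noteq> n" using oriented_graphD(3)[OF \<open>oriented_graph H\<close> 2(1)] .
        then have "c u \<noteq> c v" "c t = c v" using e by simp_all
        then show ?thesis unfolding e(1) using uniform[OF e(5) _ e(2)] by blast
      qed
    qed
    ultimately have "D = \<lparr> pverts = (\<Union>n \<in> pverts H. pverts (T n)),
        parcs = (\<Union>n \<in> pverts H. parcs (T n)) \<union>
          (\<Union>(m, n) \<in> parcs H. V (m, n) \<times> pverts (T n)) \<rparr>"
      by (intro pair_pre_digraph.equality) simp_all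
    moreover have "\<forall>m \<in> pverts H. \<forall>n \<in> pverts H. m \<noteq> n \<longrightarrow> pverts (T m) \<inter> pverts (T n) = {}"
      by (auto simp: T_def restrict_graph_def)
    moreover have "\<forall>(m, n) \<in> parcs H. V (m, n) \<subseteq> pverts (T m)"
      by (auto simp: V_def T_def restrict_graph_def)
    ultimately show ?thesis
      unfolding Psi_def using trees
      by (intro CollectI exI[of _ T] exI[of _ V] conjI) (assumption | rule ballI)+
  qed
  ultimately show ?thesis by blast
qed

end

section \<open>Deleting one vertex from the trivial code\<close>

text \<open>If a ball misses the reduced code, it is contained in \<open>{x}\<close> and
  \<open>x\<close> is a source. Otherwise two balls agree off \<open>x\<close>, and twin-freeness
  puts \<open>x\<close> in exactly one of them.\<close>

lemma deleted_vertex_separates: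
  assumes D: "oriented_graph D" "twin_free D" and x: "x \<in> pverts D"
    and not_code: "\<not> identifying_code D (pverts D - {x})" and not_source: "\<not> is_source D x"
  shows "\<exists>y \<in> pverts D. in_ball D x = insert x (in_ball D y) \<and> x \<notin> in_ball D y"
proof -
  have ball_in: "in_ball D u \<subseteq> pverts D" if "u \<in> pverts D" for u
    using that oriented_graphD[OF D(1)] by (auto simp: in_ball_iff)
  \<comment> \<open>The centre \<open>u\<close> of the larger ball must be \<open>x\<close>:
    otherwise \<open>u\<close> and \<open>v\<close> lie in each other's balls, giving opposite arcs.
    The witness is then \<open>v\<close>.\<close>
  have larger: ?thesis
    if uv: "u \<in> pverts D" "v \<in> pverts D" "x \<in> in_ball D u" "x \<notin> in_ball D v"
      "in_ball D u - {x} = in_ball D v - {x}" for u v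
  proof -
    have eq: "in_ball D u = insert x (in_ball D v)" using uv by blast
    have "u = x"
    proof (rule ccontr)
      assume "u \<noteq> x"
      then have "u \<in> in_ball D v" using eq in_ball_self[of u D] by blast
      moreover have "v \<in> in_ball D u" using eq by simp
      moreover have "u \<noteq> v" using uv by blast
      ultimately show False using oriented_graphD[OF D(1)] by (metis in_ball_iff)
    qed
    then show ?thesis using eq uv by blast
  qed
  from not_code consider
      u where "u \<in> pverts D" "in_ball D u \<inter> (pverts D - {x}) = {}"
    | u v where "u \<in> pverts D" "v \<in> pverts D" "u \<noteq> v"
        "in_ball D u \<inter> (pverts D - {x}) = in_ball D v \<inter> (pverts D - {x})"
    unfolding identifying_code_def by blast
  then show ?thesis
  proof cases
    case 1
    then have "in_ball D u \<subseteq> {x}" using ball_in by blast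
    then have "u = x" "in_ball D x \<subseteq> {x}" using in_ball_self[of u D] by blast+
    then have "is_source D x"
      using x oriented_graphD(3)[OF D(1)] by (fastforce simp: is_source_iff in_ball_iff)
    then show ?thesis using not_source by blast
  next
    case 2
    then have eq: "in_ball D u - {x} = in_ball D v - {x}" using ball_in by blast
    have "in_ball D u \<noteq> in_ball D v" using D(2) 2 by (auto simp: twin_free_def twins_def)
    then have "(x \<in> in_ball D u) \<noteq> (x \<in> in_ball D v)" using eq by blast
    then show ?thesis using larger[of u v] larger[of v u] 2 eq by auto
  qed
qed

text \<open>Oriented graphs are countable, so vertices of type \<open>nat\<close> represent every
  \<open>H\<close> up to isomorphism.\<close>

theorem theorem4:
  fixes D :: "'a pair_pre_digraph"
  assumes "oriented_graph D"
    and "infinite (pverts D)"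
    and "twin_free D"
    and "\<not> (\<exists>H :: nat pair_pre_digraph. oriented_graph H \<and> D \<in> Psi H)"
  shows "\<exists>C. C \<subset> pverts D \<and> identifying_code D C"
proof (rule ccontr)
  assume no_code: "\<nexists>C. C \<subset> pverts D \<and> identifying_code D C"
  \<comment> \<open>Both cases are put into one statement so that a single choice yields
    \<open>f\<close>, with sources as fixed points.\<close>
  have "\<exists>y \<in> pverts D. in_ball D x = insert x (in_ball D y) \<and>
      (if is_source D x then y = x else x \<notin> in_ball D y)" if x: "x \<in> pverts D" for x
  proof (cases "is_source D x")
    case True
    then show ?thesis using x by (auto intro!: bexI[of _ x])
  next
    case False
    have "\<not> identifying_code D (pverts D - {x})" using no_code x by blast
    then show ?thesis
      using deleted_vertex_separates[OF assms(1,3) x] False by simp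
  qed
  then obtain f where f: "\<And>x. x \<in> pverts D \<Longrightarrow> f x \<in> pverts D \<and>
      in_ball D x = insert x (in_ball D (f x)) \<and>
      (if is_source D x then f x = x else x \<notin> in_ball D (f x))"
    by metis
  have "stem_map D f"
  proof
    show "oriented_graph D" by (rule assms(1))
    show "f x = x" if "is_source D x" for x
      using f[of x] that by (simp add: is_source_iff[of D x])
    fix x assume x: "x \<in> pverts D"
    show "f x \<in> pverts D" "in_ball D x = insert x (in_ball D (f x))"
      using f[OF x] by blast+
    show "x \<notin> in_ball D (f x)" if "\<not> is_source D x" using f[OF x] that by presburger
  qed
  then show False using stem_map.in_Psi assms(4) by blast
qed

end
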